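(* Let $G$ be an edge-colored graph on $n$ vertices. If $e(G)+c(G)\geq n(n+1)/2$, then $G$ contains a rainbow triangle.
   Context: All graphs are simple and finite, with at least one vertex. An edge-colored graph is a graph $G=(V,E)$ together with an arbitrary mapping $C:E\to\mathbb{N}$ (not required to be a proper edge-coloring). $e(G)$ denotes the number of edges of $G$, and $c(G)$ (the color number) denotes the number of distinct colors appearing on the edges of $G$. A rainbow triangle is a triangle of $G$ whose three edges have pairwise distinct colors. *)

theory Defs
  imports Complex_Main
begin

locale simple_graph =
  fixes V :: "'a set" and E :: "'a set set"
  assumes finite_V: "finite V"
    and nonempty_V: "V \<noteq> {}"
    and edges: "e \<in> E \<Longrightarrow> e \<subseteq> V \<and> card e = 2"

text \<open>
  An edge coloring of a graph with edge set \<open>E\<close> is represented by a total function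
  \<open>C :: 'a set \<Rightarrow> nat\<close>. Only its values on \<open>E\<close> matter: neither definition below
  looks at \<open>C\<close> elsewhere.
\<close>

definition color_number :: "'a set set \<Rightarrow> ('a set \<Rightarrow> nat) \<Rightarrow> nat" where
  "color_number E C = card (C ` E)"

definition is_triangle :: "'a set set \<Rightarrow> 'a \<Rightarrow> 'a \<Rightarrow> 'a \<Rightarrow> bool" where
  "is_triangle E x y z \<longleftrightarrow>
     x \<noteq> y \<and> y \<noteq> z \<and> x \<noteq> z \<and> {x, y} \<in> E \<and> {y, z} \<in> E \<and> {x, z} \<in> E"

definition has_rainbow_triangle :: "'a set set \<Rightarrow> ('a set \<Rightarrow> nat) \<Rightarrow> bool" where
  "has_rainbow_triangle E C \<longleftrightarrow>
     (\<exists>x y z. is_triangle E x y z \<and>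
        C {x, y} \<noteq> C {y, z} \<and> C {y, z} \<noteq> C {x, z} \<and> C {x, y} \<noteq> C {x, z})"

end

(*
  Take a smallest counterexample. Deleting a vertex v loses the d(v) edges at v and the
  colors "saturated" by v, those all of whose edges contain v; if there are s(v) of them,
  minimality forces d(v) + s(v) >= n + 1. Choose one edge at v of each saturated color, and let
  T be the set of their other ends, so |T| = s(v). An edge inside T does not contain v, so its
  color is not saturated by v, and it would close a rainbow triangle with v. Hence T is
  independent, and every t in T has d(t) <= n - s(v), that is s(t) >= s(v) + 1. This is
  impossible if v maximizes s; here T is nonempty because d(v) <= n - 1.
*)
theory Submission
  imports Defs
begin

text \<open>As a difference of images, its cardinality is exactly the drop in the color number when
  \<open>v\<close> is deleted.\<close>

definition saturated_colors :: "'a set set \<Rightarrow> ('a set \<Rightarrow> nat) \<Rightarrow> 'a \<Rightarrow> nat set" where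
  "saturated_colors E C v = C ` E - C ` {e \<in> E. v \<notin> e}"

lemma has_rainbow_triangle_mono:
  "has_rainbow_triangle F C \<Longrightarrow> F \<subseteq> E \<Longrightarrow> has_rainbow_triangle E C"
  unfolding has_rainbow_triangle_def is_triangle_def by blast

context simple_graph
begin

lemma finite_E: "finite E"
  using finite_V edges by (metis PowI finite_Pow_iff finite_subset subsetI)

lemma simple_graph_delete_vertex:
  assumes "V \<noteq> {v}"
  shows "simple_graph (V - {v}) {e \<in> E. v \<notin> e}"
proof
  show "V - {v} \<noteq> {}" using assms nonempty_V by blast
qed (use finite_V edges in auto)

lemma edge_other_end:
  assumes "e \<in> E" "v \<in> e"
  obtains w where "e = {v, w}" "w \<in> V" "w \<noteq> v"
proof -
  from edges[OF assms(1)] obtain x y where "e = {x, y}" "x \<noteq> y"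
    by (meson card_2_iff)
  with edges[OF assms(1)] assms(2) that show thesis by auto
qed

text \<open>\<open>A\<close> is any finite set containing the neighbors of \<open>v\<close>: below,
  \<open>V - {v}\<close> gives the trivial bound, and \<open>V - T\<close> the bound for a vertex of
  an independent set \<open>T\<close>.\<close>

lemma degree_le:
  assumes "\<And>w. {v, w} \<in> E \<Longrightarrow> w \<in> A" "finite A"
  shows "card {e \<in> E. v \<in> e} \<le> card A"
proof -
  have "{e \<in> E. v \<in> e} \<subseteq> (\<lambda>w. {v, w}) ` A"
    using assms(1) by (blast elim: edge_other_end)
  then show ?thesis using assms(2) by (rule surj_card_le[rotated])
qed

lemma degree_less:
  assumes "v \<in> V"
  shows "card {e \<in> E. v \<in> e} < card V"
proof -
  have "w \<in> V - {v}" if "{v, w} \<in> E" for w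
    using edges[OF that] by auto
  then have "card {e \<in> E. v \<in> e} \<le> card (V - {v})"
    using finite_V by (intro degree_le) auto
  also have "\<dots> < card V"
    using finite_V assms by (intro psubset_card_mono) auto
  finally show ?thesis .
qed

lemma card_edges_delete_vertex:
  "card E = card {e \<in> E. v \<notin> e} + card {e \<in> E. v \<in> e}"
proof -
  have "card ({e \<in> E. v \<notin> e} \<union> {e \<in> E. v \<in> e})
      = card {e \<in> E. v \<notin> e} + card {e \<in> E. v \<in> e}"
    using finite_E by (intro card_Un_disjoint) auto
  moreover have "{e \<in> E. v \<notin> e} \<union> {e \<in> E. v \<in> e} = E" by blast
  ultimately show ?thesis by simp
qed

lemma color_number_delete_vertex:
  "color_number E C = color_number {e \<in> E. v \<notin> e} C + card (saturated_colors E C v)"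
proof -
  have "C ` {e \<in> E. v \<notin> e} \<subseteq> C ` E" by blast
  moreover have "finite (C ` E)" using finite_E by simp
  ultimately show ?thesis
    unfolding color_number_def saturated_colors_def
    by (simp add: card_Diff_subset finite_subset card_mono)
qed

lemma saturated_neighbours:
  assumes "\<not> has_rainbow_triangle E C"
  obtains T where "T \<subseteq> V" "card T = card (saturated_colors E C v)"
    "\<And>t t'. t \<in> T \<Longrightarrow> t' \<in> T \<Longrightarrow> {t, t'} \<notin> E"
proof -
  let ?S = "saturated_colors E C v"
  have "\<exists>w. w \<in> V \<and> w \<noteq> v \<and> {v, w} \<in> E \<and> C {v, w} = s" if s: "s \<in> ?S" for s
  proof -
    from s obtain e where e: "e \<in> E" "C e = s" "v \<in> e"
      unfolding saturated_colors_def by blast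
    from e(1,3) obtain w where "e = {v, w}" "w \<in> V" "w \<noteq> v" by (rule edge_other_end)
    with e show ?thesis by blast
  qed
  then obtain f where f: "\<And>s. s \<in> ?S \<Longrightarrow> f s \<in> V \<and> f s \<noteq> v \<and> {v, f s} \<in> E \<and> C {v, f s} = s"
    by metis
  \<comment> \<open>The color of \<open>{v, f s}\<close> is \<open>s\<close>, so \<open>f s\<close>
    determines \<open>s\<close>.\<close>
  have "inj_on f ?S" by (metis f inj_onI)
  then have card: "card (f ` ?S) = card ?S" by (rule card_image)
  have "{f s, f s'} \<notin> E" if s: "s \<in> ?S" "s' \<in> ?S" for s s'
  proof
    assume E: "{f s, f s'} \<in> E"
    with edges have ne: "f s \<noteq> f s'" by fastforce
    \<comment> \<open>Neither end is \<open>v\<close>, so this edge survives the deletion of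
      \<open>v\<close> and its color with it.\<close>
    have "C {f s, f s'} \<notin> ?S"
      using E f s unfolding saturated_colors_def by auto
    then have "C {f s, f s'} \<noteq> s" "C {f s, f s'} \<noteq> s'" using s by auto
    moreover have "s \<noteq> s'" using ne by auto
    moreover have "is_triangle E v (f s) (f s')"
      unfolding is_triangle_def using E ne f s by metis
    ultimately have "has_rainbow_triangle E C"
      unfolding has_rainbow_triangle_def using f s by metis
    with assms show False ..
  qed
  with card f show thesis by (intro that[of "f ` ?S"]) auto
qed

text \<open>Supplies the vertex to delete in the induction: removing it lowers edges plus colors by
  at most \<open>card V\<close>.\<close>

lemma exists_small_degree_plus_saturated:
  assumes "\<not> has_rainbow_triangle E C"
  shows "\<exists>v \<in> V. card {e \<in> E. v \<in> e} + card (saturated_colors E C v) \<le> card V"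
proof (rule ccontr)
  let ?s = "\<lambda>v. card (saturated_colors E C v)"
  assume "\<not> ?thesis"
  then have large: "card V < card {e \<in> E. v \<in> e} + ?s v" if "v \<in> V" for v
    using that by force
  obtain v where v: "v \<in> V" and Max: "Max (?s ` V) = ?s v"
    using finite_V nonempty_V by (rule obtains_MAX)
  have max: "?s u \<le> ?s v" if "u \<in> V" for u
    using Max[symmetric] that finite_V by simp
  obtain T where T: "T \<subseteq> V" "card T = ?s v"
    and indep: "\<And>t t'. t \<in> T \<Longrightarrow> t' \<in> T \<Longrightarrow> {t, t'} \<notin> E"
    using saturated_neighbours[OF assms] by blast
  have "?s v > 0" using large[OF v] degree_less[OF v] by linarith
  with T have "T \<noteq> {}" by auto
  then obtain t where t: "t \<in> T" by blast
  \<comment> \<open>\<open>T\<close> is independent, so all neighbors of \<open>t\<close> lie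
    outside it.\<close>
  have "w \<in> V - T" if "{t, w} \<in> E" for w
    using edges[OF that] indep[OF t] that by auto
  then have "card {e \<in> E. t \<in> e} \<le> card (V - T)"
    using finite_V by (intro degree_le) auto
  also have "\<dots> = card V - ?s v"
    using T finite_V by (simp add: card_Diff_subset finite_subset)
  \<comment> \<open>The truncated subtraction is harmless since
    \<open>card T \<le> card V\<close>.\<close>
  finally have "card {e \<in> E. t \<in> e} + ?s v \<le> card V"
    using card_mono[OF finite_V T(1)] T(2) by linarith
  \<comment> \<open>Maximality allows \<open>?s v\<close> to be replaced by \<open>?s t\<close>,
    which contradicts \<open>large\<close> at \<open>t\<close>.\<close>
  with large[of t] max[of t] t T(1) show False by fastforce
qed

end

text \<open>The contrapositive, doubled to stay within the naturals. Induction on the number of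
  vertices works because consecutive bounds n(n+1)/2 differ by exactly n, the most that one deletion
  can cost.\<close>

lemma edges_plus_colors_less:
  assumes "simple_graph V E" "\<not> has_rainbow_triangle E C"
  shows "2 * (card E + color_number E C) < card V * (card V + 1)"
  using assms
proof (induction "card V" arbitrary: V E rule: less_induct)
  case less
  interpret simple_graph V E by fact
  obtain v where v: "v \<in> V"
    and le: "card {e \<in> E. v \<in> e} + card (saturated_colors E C v) \<le> card V"
    using exists_small_degree_plus_saturated[OF less.prems(2)] by blast
  show ?case
  proof (cases "V = {v}")
    \<comment> \<open>Base case: deleting the only vertex would leave no graph. The bound reads 0 <
      2.\<close>
    case True
    with edges have "E = {}" by (fastforce dest: subset_singletonD)
    with True show ?thesis by (simp add: color_number_def)
  next
    case False
    let ?F = "{e \<in> E. v \<notin> e}"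
    obtain m where m: "card V = Suc m" "card (V - {v}) = m"
      using v finite_V by (metis card_Suc_Diff1)
    have "\<not> has_rainbow_triangle ?F C"
      using less.prems(2) has_rainbow_triangle_mono[of ?F C E] by blast
    then have "2 * (card ?F + color_number ?F C) < m * (m + 1)"
      using less.hyps[of "V - {v}" ?F] simple_graph_delete_vertex[OF False] m by simp
    \<comment> \<open>m(m+1) + 2(m+1) = (m+1)(m+2).\<close>
    with le m(1) show ?thesis
      unfolding card_edges_delete_vertex[of v] color_number_delete_vertex[of C v]
      by (simp add: algebra_simps)
  qed
qed

theorem theorem1:
  fixes V :: "'a set" and E :: "'a set set" and C :: "'a set \<Rightarrow> nat" and n :: nat
  assumes "simple_graph V E"
    and "card V = n"
    and "real (card E) + real (color_number E C) \<ge> real n * (real n + 1) / 2"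
  shows "has_rainbow_triangle E C"
proof (rule ccontr)
  assume "\<not> has_rainbow_triangle E C"
  with assms(1,2) have "2 * (card E + color_number E C) < n * (n + 1)"
    using edges_plus_colors_less by blast
  then have "real (2 * (card E + color_number E C)) < real (n * (n + 1))"
    by (simp only: of_nat_less_iff)
  with assms(3) show False by (simp add: algebra_simps)
qed

end
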